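(* Let $L'\in\mathbb{Z}_+$ and let $E,\nu$ be $1$-periodic, piecewise constant on the unit cell with $L'+1$ pieces, with $E^+,\nu^+<\infty$ and $E^-,\nu^->0$. Let $\Psi_0^\dagger$ be the homogenized constitutive map associated with $E,\nu$. For a parameter $\theta=(E_0,\nu_0,L_0,\alpha_0,\beta_0)$ in $$\Theta=\left\{(E_0,\nu_0,L_0,\alpha_0,\beta_0): E_0\in\mathbb{R}_+,\ \nu_0\in\mathbb{R}_+,\ L_0\in\mathbb{Z}_+,\ \alpha_0\in\mathbb{R}_+^{L_0},\ \beta_0\in\mathbb{R}^{L_0}\right\},$$ with $\alpha_0=(\alpha_1,\dots,\alpha_{L_0})$ and $\beta_0=(\beta_1,\dots,\beta_{L_0})$, define $$\Psi_0^{PC}\left(\partial_x u_0(t),\partial^2_{xt}u_0(t),\{\partial_x u_0(\tau)\}_{\tau\in\overline{\mathcal{T}}},t;\theta\right)=E_0\,\partial_x u_0(t)+\nu_0\,\partial^2_{xt}u_0(t)-\sum_{\ell=1}^{L_0}\xi_\ell(t),$$ $$\partial_t\xi_\ell(t)=\beta_\ell\,\partial_x u_0(t)-\alpha_\ell\,\xi_\ell(t),\qquad \xi_\ell(0)=0,\qquad \ell\in\{1,\dots,L_0\}.$$ Then there exists $\theta^*\in\Theta$, of the form $(E_0,\nu_0,L_0,\alpha_0,\beta_0)=(E',\nu',L',\alpha,\beta)$, such that $$\Psi_0^\dagger\left(\partial_x u_0(t),\partial^2_{xt}u_0(t),\{\partial_x u_0(\tau)\}_{\tau\in\overline{\mathcal{T}}},t\right)=\Psi_0^{PC}\left(\partial_x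 u_0(t),\partial^2_{xt}u_0(t),\{\partial_x u_0(\tau)\}_{\tau\in\overline{\mathcal{T}}},t;\theta^*\right)$$ for all $u_0\in C^2(\overline{\mathcal{D}}\times\overline{\mathcal{T}};\mathbb{R})$ and all $t\in\mathcal{T}$ (pointwise in the spatial variable $x$, which is suppressed in the notation).
   Context: $\mathcal{D}\subset\mathbb{R}$ is a bounded interval and $\mathcal{T}=(0,T)$ with $T<\infty$. $\mathbb{R}_+$ denotes the positive reals. For a bounded function $\xi$, $\xi^+$ and $\xi^-$ denote its essential supremum and infimum. Piecewise constant with $N$ pieces: both $E$ and $\nu$ are constant on each of $N$ common intervals $[0,a_1),[a_1,a_2),\dots,[a_{N-1},1]$ of the unit cell. Homogenized constitutive map: set $$\widehat{a}_0(s)=\left(\int_0^1\frac{dy}{s\,\nu(y)+E(y)}\right)^{-1},\quad \nu'=\left(\int_0^1\frac{dy}{\nu(y)}\right)^{-1},\quad E'=\left(\int_0^1\frac{E(y)}{\nu(y)^2}\,dy\right)\Big/\left(\int_0^1\frac{dy}{\nu(y)}\right)^{2}.$$ Then $\widehat{a}_0(s)=\nu's+E'+\widehat{\kappa}(s)$ with $\widehat{\kappa}(s)\to0$ as $s\to\infty$; let $\kappa$ be the inverse Laplace transform of $\widehat{\kappa}$. The map is $$\Psi_0^\dagger\left(\partial_x u_0(t),\partial^2_{xt}u_0(t),\{\partial_x u_0(\tau)\}_{\tau\in\overline{\mathcal{T}}},t\right)=E'\,\partial_x u_0(t)+\nu'\,\partial^2_{xt}u_0(t)+\int_0^t\kappa(t-\tau)\,\partial_x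 u_0(\tau)\,d\tau,$$ acting pointwise in $x$. *)

theory Defs
  imports "HOL-Analysis.Analysis" "HOL-Probability.Essential_Supremum"
begin

section \<open>Material functions\<close>

text \<open>\<^const>\<open>esssup\<close> needs a complete linear order, so real functions are embedded in the extended
  reals. A non-measurable function has essential supremum \<open>\<infinity>\<close> and essential infimum \<open>-\<infinity>\<close>.\<close>

definition ess_sup :: "(real \<Rightarrow> real) \<Rightarrow> ereal" where
  "ess_sup f = esssup lborel (\<lambda>y. ereal (f y))"

definition ess_inf :: "(real \<Rightarrow> real) \<Rightarrow> ereal" where
  "ess_inf f = - esssup lborel (\<lambda>y. - ereal (f y))"

definition one_periodic :: "(real \<Rightarrow> real) \<Rightarrow> bool" where
  "one_periodic f \<longleftrightarrow> (\<forall>y. f (y + 1) = f y)"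

text \<open>The pieces are half-open, including the last one: for 1-periodic functions the value at the
  right end of the unit cell is the value at 0. Neighbouring pieces may carry equal values.\<close>

definition piecewise_constant_pair :: "nat \<Rightarrow> (real \<Rightarrow> real) \<Rightarrow> (real \<Rightarrow> real) \<Rightarrow> bool" where
  "piecewise_constant_pair N E \<nu> \<longleftrightarrow>
    (\<exists>a :: nat \<Rightarrow> real. a 0 = 0 \<and> a N = 1 \<and> (\<forall>i<N. a i < a (Suc i)) \<and>
      (\<forall>i<N. \<exists>e n. \<forall>y\<in>{a i..<a (Suc i)}. E y = e \<and> \<nu> y = n))"

section \<open>Functions of class $C^k$ on a closed rectangle\<close>

text \<open>Space is the first argument, time the second. Derivatives are taken within the closed
  intervals, hence are one-sided at the end points.\<close>

definition pd_x :: "real set \<Rightarrow> (real \<Rightarrow> real \<Rightarrow> real) \<Rightarrow> real \<Rightarrow> real \<Rightarrow> real" where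
  "pd_x X u = (\<lambda>x t. vector_derivative (\<lambda>x'. u x' t) (at x within X))"

definition pd_t :: "real set \<Rightarrow> (real \<Rightarrow> real \<Rightarrow> real) \<Rightarrow> real \<Rightarrow> real \<Rightarrow> real" where
  "pd_t I u = (\<lambda>x t. vector_derivative (\<lambda>t'. u x t') (at t within I))"

primrec Ck_on :: "nat \<Rightarrow> real set \<Rightarrow> real set \<Rightarrow> (real \<Rightarrow> real \<Rightarrow> real) \<Rightarrow> bool" where
  "Ck_on 0 X I u \<longleftrightarrow> continuous_on (X \<times> I) (\<lambda>(x, t). u x t)"
| "Ck_on (Suc k) X I u \<longleftrightarrow>
     continuous_on (X \<times> I) (\<lambda>(x, t). u x t) \<and>
     (\<forall>x\<in>X. \<forall>t\<in>I. (\<lambda>x'. u x' t) differentiable (at x within X) \<and>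
                    (\<lambda>t'. u x t') differentiable (at t within I)) \<and>
     Ck_on k X I (pd_x X u) \<and> Ck_on k X I (pd_t I u)"

section \<open>The inverse Laplace transform\<close>

definition is_inverse_laplace :: "(complex \<Rightarrow> complex) \<Rightarrow> (real \<Rightarrow> real) \<Rightarrow> bool" where
  "is_inverse_laplace F f \<longleftrightarrow>
     continuous_on {0..} f \<and>
     (\<exists>c. \<forall>s. Re s > c \<longrightarrow>
        (\<lambda>t. exp (- s * of_real t) * of_real (f t)) absolutely_integrable_on {0..} \<and>
        integral {0..} (\<lambda>t. exp (- s * of_real t) * of_real (f t)) = F s)"

text \<open>Among all functions with a given Laplace transform the continuous one is selected. By Lerch's
  theorem its values on \<open>[0, \<infinity>)\<close> are unique, and only these are used.\<close>

definition inverse_laplace :: "(complex \<Rightarrow> complex) \<Rightarrow> real \<Rightarrow> real" where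
  "inverse_laplace F = (SOME f. is_inverse_laplace F f)"

section \<open>The homogenized constitutive map\<close>

definition a0_hat :: "(real \<Rightarrow> real) \<Rightarrow> (real \<Rightarrow> real) \<Rightarrow> complex \<Rightarrow> complex" where
  "a0_hat E \<nu> s = inverse (integral {0..1} (\<lambda>y. 1 / (s * of_real (\<nu> y) + of_real (E y))))"

definition nu_hom :: "(real \<Rightarrow> real) \<Rightarrow> real" where
  "nu_hom \<nu> = inverse (integral {0..1} (\<lambda>y. 1 / \<nu> y))"

definition E_hom :: "(real \<Rightarrow> real) \<Rightarrow> (real \<Rightarrow> real) \<Rightarrow> real" where
  "E_hom E \<nu> = integral {0..1} (\<lambda>y. E y / (\<nu> y)\<^sup>2) / (integral {0..1} (\<lambda>y. 1 / \<nu> y))\<^sup>2"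

definition kappa_hat :: "(real \<Rightarrow> real) \<Rightarrow> (real \<Rightarrow> real) \<Rightarrow> complex \<Rightarrow> complex" where
  "kappa_hat E \<nu> s = a0_hat E \<nu> s - of_real (nu_hom \<nu>) * s - of_real (E_hom E \<nu>)"

definition kappa :: "(real \<Rightarrow> real) \<Rightarrow> (real \<Rightarrow> real) \<Rightarrow> real \<Rightarrow> real" where
  "kappa E \<nu> = inverse_laplace (kappa_hat E \<nu>)"

text \<open>In both constitutive maps, \<open>p\<close> is the strain, \<open>q\<close> the strain rate at time \<open>t\<close>,
  and \<open>w\<close> the strain history.\<close>

definition Psi_dagger ::
  "(real \<Rightarrow> real) \<Rightarrow> (real \<Rightarrow> real) \<Rightarrow> real \<Rightarrow> real \<Rightarrow> (real \<Rightarrow> real) \<Rightarrow> real \<Rightarrow> real" where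
  "Psi_dagger E \<nu> p q w t =
     E_hom E \<nu> * p + nu_hom \<nu> * q + integral {0..t} (\<lambda>\<tau>. kappa E \<nu> (t - \<tau>) * w \<tau>)"

section \<open>The piecewise-constant model\<close>

type_synonym param = "real \<times> real \<times> nat \<times> real list \<times> real list"

definition Theta :: "param set" where
  "Theta = {(E\<^sub>0, \<nu>\<^sub>0, L\<^sub>0, \<alpha>\<^sub>0, \<beta>\<^sub>0). E\<^sub>0 > 0 \<and> \<nu>\<^sub>0 > 0 \<and> L\<^sub>0 > 0 \<and>
     length \<alpha>\<^sub>0 = L\<^sub>0 \<and> (\<forall>r\<in>set \<alpha>\<^sub>0. r > 0) \<and> length \<beta>\<^sub>0 = L\<^sub>0}"

definition solves_internal :: "real \<Rightarrow> real \<Rightarrow> real \<Rightarrow> (real \<Rightarrow> real) \<Rightarrow> (real \<Rightarrow> real) \<Rightarrow> bool" where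
  "solves_internal T \<alpha> \<beta> w \<xi> \<longleftrightarrow> \<xi> 0 = 0 \<and>
     (\<forall>t\<in>{0..T}. (\<xi> has_real_derivative (\<beta> * w t - \<alpha> * \<xi> t)) (at t within {0..T}))"

text \<open>The solution is unique on \<open>[0, T]\<close> and exists for continuous \<open>w\<close>; the choice only concerns
  irrelevant values outside of that interval.\<close>

definition internal_variable :: "real \<Rightarrow> real \<Rightarrow> real \<Rightarrow> (real \<Rightarrow> real) \<Rightarrow> real \<Rightarrow> real" where
  "internal_variable T \<alpha> \<beta> w = (SOME \<xi>. solves_internal T \<alpha> \<beta> w \<xi>)"

definition Psi_PC :: "real \<Rightarrow> real \<Rightarrow> real \<Rightarrow> (real \<Rightarrow> real) \<Rightarrow> real \<Rightarrow> param \<Rightarrow> real" where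
  "Psi_PC T p q w t \<theta> = (case \<theta> of (E\<^sub>0, \<nu>\<^sub>0, L\<^sub>0, \<alpha>\<^sub>0, \<beta>\<^sub>0) \<Rightarrow>
     E\<^sub>0 * p + \<nu>\<^sub>0 * q - (\<Sum>l<L\<^sub>0. internal_variable T (\<alpha>\<^sub>0 ! l) (\<beta>\<^sub>0 ! l) w t))"

end

theory Submission
  imports Defs "HOL-Computational_Algebra.Fundamental_Theorem_Algebra"
begin

text \<open>For piecewise constant data, \<open>1 / a0_hat s\<close> is a sum \<open>g s = \<Sum>w / (s + r)\<close> of simple poles
  at the negated ratios \<open>r = E / \<nu>\<close>, with positive weights. The imaginary part, the real part
  and the derivative of \<open>g\<close> have a sign, so that the zeros of \<open>g\<close> are real, negative and simple;
  hence \<open>1 / g\<close> is a linear function plus simple poles at these zeros \<open>- \<alpha>\<close>. Thus \<open>\<kappa>\<close> is a sum of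
  exponentials \<open>exp (- \<alpha> t)\<close>, by Lerch's theorem, and the convolution with each of them solves the
  equation of an internal variable by variation of constants.\<close>

section \<open>Reciprocals of sums of simple poles\<close>

text \<open>Lagrange interpolation: \<open>p\<close> and its interpolant \<open>l\<close> at the
  nodes \<open>S\<close> agree on \<open>S\<close>, and both have degree below
  \<open>card S\<close>. Bounding the coefficients rather than \<open>degree p\<close> also covers
  empty \<open>S\<close>, where it forces \<open>p = 0\<close>.\<close>

lemma partial_fraction_decomposition:
  fixes p :: "'a::field poly"
  assumes fin: "finite S" and deg: "\<And>k. card S \<le> k \<Longrightarrow> coeff p k = 0" and x: "x \<notin> S"
  shows "poly p x / (\<Prod>a\<in>S. x - a) = (\<Sum>a\<in>S. (poly p a / (\<Prod>b\<in>S - {a}. a - b)) / (x - a))"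
proof (cases "S = {}")
  case True
  then have "p = 0" using deg by (intro poly_eqI) auto
  with True show ?thesis by simp
next
  case False
  define c where "c a = poly p a / (\<Prod>b\<in>S - {a}. a - b)" for a
  define l where "l = (\<Sum>a\<in>S. smult (c a) (\<Prod>b\<in>S - {a}. [:- b, 1:]))"
  have card_pos: "0 < card S" using False fin by (simp add: card_gt_0_iff)
  have poly_l: "poly l z = (\<Sum>a\<in>S. c a * (\<Prod>b\<in>S - {a}. z - b))" for z
    by (simp add: l_def poly_sum poly_prod)
  have "p = l"
  proof (rule poly_eqI_degree[where A = S])
    \<comment> \<open>Otherwise the leading coefficient would vanish, so \<open>p = 0\<close>, whose
      degree 0 still lies below the positive \<open>card S\<close>.\<close>
    show "degree p < card S"
      using deg card_pos by (metis leI leading_coeff_0_iff degree_0)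
    have "degree (smult (c a) (\<Prod>b\<in>S - {a}. [:- b, 1:])) \<le> card S - 1" if "a \<in> S" for a
      using fin that by (intro order_trans[OF degree_smult_le]) (simp add: degree_prod_sum_eq)
    then have "degree l \<le> card S - 1" unfolding l_def by (intro degree_sum_le fin) auto
    then show "degree l < card S" using card_pos by linarith
  next
    fix z assume z: "z \<in> S"
    have "c a * (\<Prod>b\<in>S - {a}. z - b) = (if a = z then poly p z else 0)" if "a \<in> S" for a
    proof (cases "a = z")
      case False
      then have "(\<Prod>b\<in>S - {a}. z - b) = 0" using z fin by (intro prod_zero) auto
      then show ?thesis using False by simp
    qed (use fin in \<open>auto simp: c_def prod_zero_iff\<close>)
    then show "poly p z = poly l z" using fin z by (simp add: poly_l)
  qed
  then have "poly p x / (\<Prod>a\<in>S. x - a) = (\<Sum>a\<in>S. c a * (\<Prod>b\<in>S - {a}. x - b) / (\<Prod>a\<in>S. x - a))"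
    by (simp add: poly_l sum_divide_distrib)
  also have "\<dots> = (\<Sum>a\<in>S. c a / (x - a))"
  proof (intro sum.cong refl)
    fix a assume a: "a \<in> S"
    have "(\<Prod>b\<in>S - {a}. x - b) \<noteq> 0" using x fin by (auto simp: prod_zero_iff)
    then show "c a * (\<Prod>b\<in>S - {a}. x - b) / (\<Prod>a\<in>S. x - a) = c a / (x - a)"
      using fin a by (simp add: prod.remove[of S a])
  qed
  finally show ?thesis by (simp add: c_def)
qed

text \<open>\<open>pole_numerator R v\<close> is the numerator of the partial fraction sum
  \<open>\<Sum>r\<in>R. v r / (s + r)\<close> over the common denominator \<open>\<Prod>r\<in>R. s + r\<close>.\<close>

definition pole_numerator :: "real set \<Rightarrow> (real \<Rightarrow> real) \<Rightarrow> complex poly" where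
  "pole_numerator R v =
     (\<Sum>i\<in>R. smult (of_real (v i)) (\<Prod>j\<in>R - {i}. [:of_real j, 1:]))"

lemma poly_pole_numerator:
  "poly (pole_numerator R v) s = (\<Sum>i\<in>R. of_real (v i) * (\<Prod>j\<in>R - {i}. s + of_real j))"
  by (simp add: pole_numerator_def poly_sum poly_prod add.commute)

lemma poly_pole_numerator_nonpole:
  assumes "finite R" and "\<And>i. i \<in> R \<Longrightarrow> s + of_real i \<noteq> 0"
  shows "poly (pole_numerator R v) s =
    (\<Prod>i\<in>R. s + of_real i) * (\<Sum>i\<in>R. of_real (v i) / (s + of_real i))"
  unfolding poly_pole_numerator sum_distrib_left
  using assms by (intro sum.cong refl) (simp add: prod.remove field_simps)

text \<open>Every summand except the one of index \<open>i\<close> keeps the factor that vanishes at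
  this point. Hence no pole with nonzero weight is a root of the numerator.\<close>

lemma poly_pole_numerator_pole:
  assumes "finite R" and "i \<in> R"
  shows "poly (pole_numerator R v) (- of_real i) =
    of_real (v i) * (\<Prod>j\<in>R - {i}. of_real j - of_real i)"
proof -
  have "(\<Prod>j\<in>R - {k}. complex_of_real j - of_real i) = 0" if "k \<in> R - {i}" for k
    using assms that by (intro prod_zero) auto
  then show ?thesis
    using assms by (simp add: poly_pole_numerator sum.remove[of R i] sum.neutral)
qed

text \<open>Each summand is a weight times a product of \<open>card R - 1\<close> monic linear
  factors. Positive weights thus fix the degree at \<open>card R - 1\<close>, and weights of total 0
  push it lower; both cases occur below.\<close>

lemma coeff_pole_numerator:
  assumes "finite R"
  shows "coeff (pole_numerator R v) (card R - 1) = of_real (\<Sum>i\<in>R. v i)"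
    and "card R \<le> k \<Longrightarrow> coeff (pole_numerator R v) k = 0"
proof -
  define M :: "real \<Rightarrow> complex poly" where "M i = (\<Prod>j\<in>R - {i}. [:of_real j, 1:])" for i
  have deg: "degree (M i) = card R - 1" if "i \<in> R" for i
    using assms that by (simp add: M_def degree_prod_sum_eq)
  have "coeff (M i) (card R - 1) = 1" if "i \<in> R" for i
    using deg[OF that] lead_coeff_prod[of "\<lambda>j. [:of_real j, 1:] :: complex poly" "R - {i}"]
    by (simp add: M_def)
  then show "coeff (pole_numerator R v) (card R - 1) = of_real (\<Sum>i\<in>R. v i)"
    by (simp add: pole_numerator_def coeff_sum flip: M_def)
  show "coeff (pole_numerator R v) k = 0" if "card R \<le> k"
  proof -
    have "coeff (M i) k = 0" if "i \<in> R" for i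
      using deg[OF that] \<open>card R \<le> k\<close> assms that card_gt_0_iff[of R]
      by (intro coeff_eq_0) (auto; linarith)
    then show ?thesis by (simp add: pole_numerator_def coeff_sum flip: M_def)
  qed
qed

section \<open>Location and simplicity of the zeros\<close>

lemma pole_sum_root:
  fixes R :: "real set" and w :: "real \<Rightarrow> real"
  assumes fin: "finite R" "R \<noteq> {}" and pos: "\<forall>r\<in>R. 0 < r \<and> 0 < w r"
    and nz: "\<And>r. r \<in> R \<Longrightarrow> s + of_real r \<noteq> 0"
    and root: "(\<Sum>r\<in>R. of_real (w r) / (s + of_real r)) = 0"
  shows "Im s = 0" and "Re s < 0"
proof -
  have nn: "0 < w r / (cmod (s + of_real r))\<^sup>2" if "r \<in> R" for r
    using nz[OF that] pos that by simp
  \<comment> \<open>Multiplying numerator and denominator by the conjugate of \<open>s + r\<close>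
    pulls out the factor \<open>- Im s\<close>, common to all summands; what remains is
    positive.\<close>
  have "Im (of_real (w r) / (s + of_real r)) = - Im s * (w r / (cmod (s + of_real r))\<^sup>2)" for r
    by (simp add: Im_divide cmod_def field_simps)
  then have "0 = - Im s * (\<Sum>r\<in>R. w r / (cmod (s + of_real r))\<^sup>2)"
    using arg_cong[OF root, of Im] by (simp add: sum_distrib_left)
  moreover have "0 < (\<Sum>r\<in>R. w r / (cmod (s + of_real r))\<^sup>2)"
    using nn fin by (intro sum_pos) auto
  ultimately show "Im s = 0" by simp
  show "Re s < 0"
  proof (rule ccontr)
    assume "\<not> Re s < 0"
    have "Re (of_real (w r) / (s + of_real r)) = (Re s + r) * (w r / (cmod (s + of_real r))\<^sup>2)" for r
      by (simp add: Re_divide cmod_def field_simps)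
    then have "0 = (\<Sum>r\<in>R. (Re s + r) * (w r / (cmod (s + of_real r))\<^sup>2))"
      using arg_cong[OF root, of Re] by simp
    moreover have "0 < (\<Sum>r\<in>R. (Re s + r) * (w r / (cmod (s + of_real r))\<^sup>2))"
      using nn fin pos \<open>\<not> Re s < 0\<close> by (intro sum_pos mult_pos_pos add_nonneg_pos) auto
    ultimately show False by simp
  qed
qed

text \<open>Off the poles the numerator is \<open>?P * ?g\<close>, so its roots are zeros of
  \<open>?g\<close>. At such a zero its derivative is \<open>?P * g'\<close>, and for real
  \<open>s\<close> the value \<open>g'\<close> is a sum of negative terms.\<close>

lemma pole_numerator_roots:
  fixes R :: "real set" and w :: "real \<Rightarrow> real"
  assumes fin: "finite R" "R \<noteq> {}" and pos: "\<forall>r\<in>R. 0 < r \<and> 0 < w r"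
    and root: "poly (pole_numerator R w) s = 0"
  shows "Im s = 0" and "Re s < 0" and "poly (pderiv (pole_numerator R w)) s \<noteq> 0"
proof -
  let ?Q = "pole_numerator R w"
  \<comment> \<open>At a pole the numerator is a positive weight times nonzero differences of
    distinct elements of \<open>R\<close>, so a root cannot be a pole.\<close>
  have nz: "s + of_real r \<noteq> 0" if "r \<in> R" for r
  proof
    assume "s + of_real r = 0"
    then have "s = - of_real r" by (simp add: add_eq_0_iff2)
    then show False
      using poly_pole_numerator_pole[OF fin(1) that, of w] root pos fin(1) that
      by (auto simp: prod_zero_iff)
  qed
  let ?P = "\<lambda>s. \<Prod>r\<in>R. s + complex_of_real r"
  let ?g = "\<lambda>s. \<Sum>r\<in>R. complex_of_real (w r) / (s + of_real r)"
  have P: "?P s \<noteq> 0" using nz fin by (auto simp: prod_zero_iff)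
  have g: "?g s = 0"
    using poly_pole_numerator_nonpole[OF fin(1) nz, where v = w] root P by simp
  show im: "Im s = 0" and re: "Re s < 0"
    using pole_sum_root[OF fin pos nz g] by auto
  show "poly (pderiv ?Q) s \<noteq> 0"
  proof
    assume 0: "poly (pderiv ?Q) s = 0"
    define g' where "g' = (\<Sum>r\<in>R. - of_real (w r) / (s + complex_of_real r)\<^sup>2)"
    have dg: "(?g has_field_derivative g') (at s)"
      unfolding g'_def using nz
      by (auto intro!: derivative_eq_intros sum.cong simp: power2_eq_square)
    obtain P' where dP: "(?P has_field_derivative P') (at s)"
    proof -
      have "?P = poly (\<Prod>r\<in>R. [:of_real r, 1:])" by (simp add: poly_prod fun_eq_iff add.commute)
      then show ?thesis using poly_DERIV that by metis
    qed
    \<comment> \<open>The other term \<open>P' * ?g s\<close> of the product rule drops out because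
      \<open>?g s = 0\<close>, so the value of \<open>P'\<close> is irrelevant.\<close>
    have dPg: "((\<lambda>s. ?P s * ?g s) has_field_derivative ?P s * g') (at s)"
      by (rule DERIV_cong[OF DERIV_mult[OF dP dg]]) (simp only: g, simp)
    \<comment> \<open>The factorization holds only off the poles; their complement is an open
      neighbourhood of \<open>s\<close>, which is enough for derivatives.\<close>
    have "open (- (\<lambda>r. - complex_of_real r) ` R)"
      using fin by (intro open_Compl finite_imp_closed finite_imageI)
    moreover have "s \<in> - (\<lambda>r. - complex_of_real r) ` R"
      using nz by force
    ultimately have "(poly ?Q has_field_derivative ?P s * g') (at s)"
      by (rule has_field_derivative_transform_within_open[OF dPg])
        (subst poly_pole_numerator_nonpole[OF fin(1)], auto simp: add_eq_0_iff2)
    then have "?P s * g' = 0" using DERIV_unique[OF poly_DERIV] 0 by metis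
    then have "Re g' = 0" using P by simp
    moreover have "s = of_real (Re s)" using im by (simp add: complex_eq_iff)
    then have "g' = of_real (\<Sum>r\<in>R. - w r / (Re s + r)\<^sup>2)"
      unfolding g'_def by (metis (no_types, lifting) of_real_sum of_real_divide of_real_minus of_real_add of_real_power sum.cong)
    then have "Re g' = - (\<Sum>r\<in>R. w r / (Re s + r)\<^sup>2)" by (simp add: sum_negf)
    moreover have "0 < (\<Sum>r\<in>R. w r / (Re s + r)\<^sup>2)"
    proof (intro sum_pos fin divide_pos_pos)
      fix r assume "r \<in> R"
      then have "Re s + r \<noteq> 0" using nz[of r] im by (auto simp: complex_eq_iff)
      then show "0 < (Re s + r)\<^sup>2" by simp
      show "0 < w r" using pos \<open>r \<in> R\<close> by blast
    qed
    ultimately show False by simp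
  qed
qed

text \<open>Simple roots make the numerator squarefree, so over the complex numbers it is its
  leading coefficient times distinct linear factors.\<close>

lemma pole_numerator_factorization:
  fixes R :: "real set" and w :: "real \<Rightarrow> real"
  assumes fin: "finite R" "R \<noteq> {}" and pos: "\<forall>r\<in>R. 0 < r \<and> 0 < w r"
  obtains S :: "real set" where "finite S" "card S = card R - 1" "\<And>a. a \<in> S \<Longrightarrow> 0 < a"
    "\<And>s. poly (pole_numerator R w) s = of_real (\<Sum>r\<in>R. w r) * (\<Prod>a\<in>S. s + of_real a)"
proof -
  let ?Q = "pole_numerator R w"
  define W where "W = (\<Sum>r\<in>R. w r)"
  have W: "W > 0" unfolding W_def using fin pos by (intro sum_pos) auto
  have cW: "coeff ?Q (card R - 1) = of_real W"
    using coeff_pole_numerator(1)[OF fin(1)] by (simp add: W_def)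
  have deg: "degree ?Q = card R - 1"
  proof (rule antisym)
    show "degree ?Q \<le> card R - 1"
      using coeff_pole_numerator(2)[OF fin(1)] by (intro degree_le) auto
    show "card R - 1 \<le> degree ?Q" using cW W by (intro le_degree) simp
  qed
  have Q0: "?Q \<noteq> 0" using cW W by auto
  have "rsquarefree ?Q"
    unfolding rsquarefree_roots using pole_numerator_roots(3)[OF fin pos] by blast
  then have Q: "?Q = smult (of_real W) (\<Prod>z | poly ?Q z = 0. [:- z, 1:])"
    using complex_poly_decompose_rsquarefree[of ?Q] deg cW by simp
  \<comment> \<open>The roots are negated so that the factors read \<open>s + a\<close> with
    positive \<open>a\<close>, the later relaxation rates.\<close>
  define S where "S = {a. poly ?Q (- of_real a) = 0}"
  have Z: "{z. poly ?Q z = 0} = (\<lambda>a. - of_real a) ` S"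
  proof (intro set_eqI iffI)
    fix z assume "z \<in> {z. poly ?Q z = 0}"
    then have "Im z = 0" "poly ?Q z = 0" using pole_numerator_roots(1)[OF fin pos] by auto
    then have "z = - of_real (- Re z)" "poly ?Q (- of_real (- Re z)) = 0"
      by (simp_all add: complex_eq_iff) (metis complex_is_Real_iff of_real_Re)
    then show "z \<in> (\<lambda>a. - of_real a) ` S" unfolding S_def by blast
  qed (auto simp: S_def)
  have inj: "inj_on (\<lambda>a. - complex_of_real a) S" by (auto simp: inj_on_def)
  have finS: "finite S"
    using poly_roots_finite[OF Q0] unfolding Z by (simp add: finite_image_iff[OF inj])
  have Q': "?Q = smult (of_real W) (\<Prod>a\<in>S. [:of_real a, 1:])"
    by (subst Q) (simp add: Z prod.reindex[OF inj])
  show ?thesis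
  proof
    show "finite S" by (fact finS)
    have "degree ?Q = card S"
      using W by (subst Q') (simp add: degree_prod_sum_eq)
    then show "card S = card R - 1" using deg by simp
    show "0 < a" if "a \<in> S" for a
      using pole_numerator_roots(2)[OF fin pos, of "- of_real a"] that by (simp add: S_def)
    show "poly ?Q s = of_real (\<Sum>r\<in>R. w r) * (\<Prod>a\<in>S. s + of_real a)" for s
      by (subst Q') (simp add: poly_prod W_def add.commute)
  qed
qed

text \<open>The linear part \<open>(s + m) / W\<close> is split off by subtracting the weighted mean \<open>m\<close> of the
  poles, which makes the leading coefficient of the remaining numerator vanish.\<close>

lemma inverse_pole_sum:
  fixes R :: "real set" and w :: "real \<Rightarrow> real"
  assumes fin: "finite R" "R \<noteq> {}" and pos: "\<forall>r\<in>R. 0 < r \<and> 0 < w r"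
  defines "W \<equiv> \<Sum>r\<in>R. w r"
  obtains S :: "real set" and c :: "real \<Rightarrow> real" where
    "finite S" "card S = card R - 1" "\<And>a. a \<in> S \<Longrightarrow> 0 < a"
    "\<And>s. 0 < Re s \<Longrightarrow> inverse (\<Sum>r\<in>R. of_real (w r) / (s + of_real r)) =
      of_real (1 / W) * s + of_real ((\<Sum>r\<in>R. w r * r) / W\<^sup>2) + (\<Sum>a\<in>S. of_real (c a) / (s + of_real a))"
proof -
  have W: "W > 0" unfolding W_def using fin pos by (intro sum_pos) auto
  define m where "m = (\<Sum>r\<in>R. w r * r) / W"
  obtain S where S: "finite S" "card S = card R - 1" "\<And>a. a \<in> S \<Longrightarrow> 0 < a"
    and Q: "\<And>s. poly (pole_numerator R w) s = of_real W * (\<Prod>a\<in>S. s + of_real a)"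
    using pole_numerator_factorization[OF fin pos] unfolding W_def by metis
  \<comment> \<open>Since \<open>w - (s + m) * w / (s + r) = w * (r - m) / (s + r)\<close>, these
    are the weights of the remainder \<open>W - (s + m) * g s\<close>.\<close>
  define v where "v r = w r * (r - m)" for r
  have "(\<Sum>r\<in>R. v r) = 0"
    using W by (simp add: v_def right_diff_distrib sum_subtractf flip: sum_distrib_right) (simp add: m_def flip: W_def)
  \<comment> \<open>The index \<open>card S = card R - 1\<close> is the one that the general degree
    bound leaves open; there the coefficient is the total weight, which is 0. So the degree is small
    enough for partial fractions over the roots.\<close>
  then have low: "coeff (pole_numerator R v) k = 0" if "card S \<le> k" for k
    using coeff_pole_numerator[OF fin(1), where v = v] that S(2) fin
    by (cases "k = card R - 1") auto
  define Z where "Z = (\<lambda>a. - complex_of_real a) ` S"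
  have inj: "inj_on (\<lambda>a. - complex_of_real a) S" by (auto simp: inj_on_def)
  define d where "d z = poly (pole_numerator R v) z / (\<Prod>b\<in>Z - {z}. z - b)" for z
  \<comment> \<open>\<open>d\<close> is the residue of the remaining numerator over
    \<open>\<Prod>a\<in>S. s + a\<close>; dividing that quotient by \<open>W\<^sup>2\<close> gives
    the non-linear part of the reciprocal. Taking \<open>Re\<close> loses nothing, as all data are
    real.\<close>
  define c where "c a = Re (d (- of_real a)) / W\<^sup>2" for a
  have d_real: "d (- of_real a) = of_real (Re (d (- of_real a)))" if "a \<in> S" for a
  proof -
    have "d (- of_real a) \<in> \<real>"
      unfolding d_def poly_pole_numerator Z_def
      by (intro Reals_divide sum_in_Reals prod_in_Reals Reals_mult Reals_add Reals_diff Reals_minus) auto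
    then show ?thesis by simp
  qed
  show ?thesis
  proof
    show "finite S" "card S = card R - 1" "\<And>a. a \<in> S \<Longrightarrow> 0 < a" by (fact S)+
    fix s :: complex assume s: "0 < Re s"
    have nz: "s + of_real r \<noteq> 0" if "r > 0" for r
      using s that by (auto simp: complex_eq_iff)
    let ?g = "\<Sum>r\<in>R. of_real (w r) / (s + of_real r)"
    let ?P = "\<Prod>r\<in>R. s + of_real r"
    let ?q = "\<Prod>a\<in>S. s + of_real a"
    have P: "?P \<noteq> 0" using nz pos fin by (auto simp: prod_zero_iff)
    have q: "?q \<noteq> 0" using nz S by (auto simp: prod_zero_iff)
    have Pg: "?P * ?g = of_real W * ?q"
      using poly_pole_numerator_nonpole[OF fin(1), of s w] nz pos Q by auto
    have g0: "?g \<noteq> 0" using Pg P q W by auto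
    have summand: "of_real (v r) / (s + of_real r) = of_real (w r) - (s + of_real m) * (of_real (w r) / (s + of_real r))"
      if "r \<in> R" for r
      using nz[of r] pos that by (simp add: v_def field_simps)
    have "poly (pole_numerator R v) s = ?P * (\<Sum>r\<in>R. of_real (v r) / (s + of_real r))"
      using nz pos by (intro poly_pole_numerator_nonpole fin) auto
    also have "(\<Sum>r\<in>R. of_real (v r) / (s + of_real r)) = of_real W - (s + of_real m) * ?g"
      by (simp add: summand sum_subtractf W_def sum_distrib_left)
    finally have v: "poly (pole_numerator R v) s = ?P * (of_real W - (s + of_real m) * ?g)" .
    have "(\<Prod>z\<in>Z. s - z) = ?q"
      by (simp add: Z_def prod.reindex[OF inj])
    moreover have "s \<notin> Z" using nz S(3) by (force simp: Z_def)
    ultimately have "poly (pole_numerator R v) s / ?q = (\<Sum>z\<in>Z. d z / (s - z))"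
      using partial_fraction_decomposition[of Z "pole_numerator R v" s] low S(1)
      by (simp add: d_def Z_def card_image[OF inj])
    also have "\<dots> = of_real (W\<^sup>2) * (\<Sum>a\<in>S. of_real (c a) / (s + of_real a))"
      using W d_real by (simp add: Z_def sum.reindex[OF inj] sum_distrib_left c_def)
    finally have pf: "poly (pole_numerator R v) s / ?q
      = of_real (W\<^sup>2) * (\<Sum>a\<in>S. of_real (c a) / (s + of_real a))" .
    have cancel: "x = (s + of_real m) / of_real W + y"
      if "(of_real W)\<^sup>2 * y = (of_real W)\<^sup>2 * x - of_real W * (s + of_real m)" for x y :: complex
    proof -
      have "of_real W * (of_real W * x) = of_real W * (of_real W * y + (s + of_real m))"
        using that by (simp add: power2_eq_square algebra_simps)
      then have "of_real W * x = of_real W * y + (s + of_real m)"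
        using W by (simp only: mult_cancel_left) simp
      then show ?thesis using W by (simp add: field_simps)
    qed
    have "?P / ?q = of_real W / ?g" using Pg q g0 by (simp add: field_simps)
    then have "poly (pole_numerator R v) s / ?q = of_real W / ?g * (of_real W - (s + of_real m) * ?g)"
      by (simp only: v times_divide_eq_left[symmetric])
    also have "\<dots> = (of_real W)\<^sup>2 * inverse ?g - of_real W * (s + of_real m)"
      using g0 by (simp add: field_simps power2_eq_square)
    finally have "inverse ?g = (s + of_real m) / of_real W + (\<Sum>a\<in>S. of_real (c a) / (s + of_real a))"
      using pf cancel[of "\<Sum>a\<in>S. of_real (c a) / (s + of_real a)" "inverse ?g"] by simp
    then show "inverse ?g = of_real (1 / W) * s + of_real ((\<Sum>r\<in>R. w r * r) / W\<^sup>2)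
        + (\<Sum>a\<in>S. of_real (c a) / (s + of_real a))"
      using W by (simp add: m_def add_divide_distrib power2_eq_square)
  qed
qed

section \<open>Laplace transforms\<close>

text \<open>With \<open>z = s + \<alpha>\<close> the integrand is \<open>exp (- z * t)\<close>. Its
  antiderivative \<open>- exp (- z * t) / z\<close> tends to 0 at infinity because
  \<open>Re z > 0\<close>.\<close>

lemma laplace_exponential:
  fixes s :: complex and \<alpha> :: real
  assumes "0 < Re s + \<alpha>"
  shows "(\<lambda>t. exp (- s * of_real t) * of_real (exp (- \<alpha> * t))) absolutely_integrable_on {0..}"
    and "integral {0..} (\<lambda>t. exp (- s * of_real t) * of_real (exp (- \<alpha> * t))) = 1 / (s + of_real \<alpha>)"
proof -
  define z where "z = s + of_real \<alpha>"
  have z: "0 < Re z" and z0: "z \<noteq> 0" using assms by (auto simp: z_def complex_eq_iff)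
  have eq: "exp (- s * of_real t) * of_real (exp (- \<alpha> * t)) = exp (- z * of_real t)" for t
    by (simp add: z_def exp_of_real[symmetric] exp_add[symmetric] algebra_simps)
  have nrm: "norm (exp (- z * of_real t)) = exp (- Re z * t)" for t by simp
  \<comment> \<open>Integrability is shown over \<open>lborel\<close>, as the fundamental theorem
    for interval integrals requires, and carried to the completed measure afterwards.\<close>
  have bint: "set_integrable lborel {0..} (\<lambda>t. exp (- z * of_real t))"
  proof (rule set_integrable_bound)
    show "set_integrable lborel {0..} (\<lambda>t. exp (- Re z * t))"
    proof -
      have "(\<lambda>t. exp (- Re z * t)) absolutely_integrable_on {0..}"
        using integrable_on_exp_minus_to_infinity[OF z] by (intro nonnegative_absolutely_integrable_1) auto
      then show ?thesis
        unfolding set_integrable_def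
        by (subst (asm) integrable_completion) (auto intro!: borel_measurable_continuous_onI continuous_intros)
    qed
  qed (auto simp: set_borel_measurable_def intro!: borel_measurable_continuous_onI continuous_intros)
  then have "(\<lambda>t. exp (- z * of_real t)) absolutely_integrable_on {0..}"
    unfolding set_integrable_def by (subst integrable_completion) (auto intro!: borel_measurable_continuous_onI continuous_intros)
  then show "(\<lambda>t. exp (- s * of_real t) * of_real (exp (- \<alpha> * t))) absolutely_integrable_on {0..}"
    by (simp only: eq)
  have "(LBINT t=0..\<infinity>. exp (- z * of_real t)) = 0 - (- 1 / z)"
  proof (rule interval_integral_FTC_integrable)
    show "((\<lambda>t. - exp (- z * of_real t) / z) has_vector_derivative exp (- z * of_real x)) (at x)" for x
      using z0 by (auto intro!: derivative_eq_intros has_vector_derivative_real_field)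
    show "set_integrable lborel (einterval 0 \<infinity>) (\<lambda>t. exp (- z * of_real t))"
      by (rule set_integrable_subset[OF bint]) (auto simp: einterval_def)
    show "(((\<lambda>t. - exp (- z * of_real t) / z) \<circ> real_of_ereal) \<longlongrightarrow> - 1 / z) (at_right 0)"
      unfolding zero_ereal_def ereal_tendsto_simps using z0 by (auto intro!: tendsto_eq_intros)
    have "((\<lambda>t. exp (- Re z * t)) \<longlongrightarrow> 0) at_top"
      using z by real_asymp
    then have "((\<lambda>t. exp (- z * complex_of_real t)) \<longlongrightarrow> 0) at_top"
      by (subst tendsto_norm_zero_iff[symmetric]) simp
    then show "(((\<lambda>t. - exp (- z * of_real t) / z) \<circ> real_of_ereal) \<longlongrightarrow> 0) (at_left \<infinity>)"
      unfolding ereal_tendsto_simps using tendsto_divide[OF tendsto_minus tendsto_const[of z]] z0 by fastforce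
  qed (auto intro!: continuous_intros)
  moreover have "(LBINT t=0..\<infinity>. exp (- z * of_real t)) = (LBINT t:{0<..}. exp (- z * of_real t))"
    by (simp add: interval_integral_to_infinity_eq zero_ereal_def)
  moreover have "\<dots> = integral {0<..} (\<lambda>t. exp (- z * of_real t))"
    by (rule set_borel_integral_eq_integral) (rule set_integrable_subset[OF bint], auto)
  moreover have "\<dots> = integral {0..} (\<lambda>t. exp (- z * of_real t))"
    by (rule integral_spike_set; rule negligible_subset[of "{0}"]) auto
  ultimately show "integral {0..} (\<lambda>t. exp (- s * of_real t) * of_real (exp (- \<alpha> * t))) = 1 / (s + of_real \<alpha>)"
    by (simp only: eq) (simp add: z_def)
qed

text \<open>After the substitution \<open>x = exp (- t)\<close>, polynomials in \<open>x\<close> approximate a truncation of \<open>H\<close>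
  uniformly on \<open>[0, 1]\<close>.\<close>

lemma exp_moments_zero_imp_zero:
  fixes H :: "real \<Rightarrow> real"
  assumes cont: "continuous_on {0..} H" and int: "H absolutely_integrable_on {0..}"
    and mom: "\<And>n::nat. integral {0..} (\<lambda>t. exp (- real n * t) * H t) = 0"
    and t: "0 \<le> t"
  shows "H t = 0"
proof -
  \<comment> \<open>For nonnegative \<open>t\<close> the value \<open>exp (- t)\<close> stays in the
    unit interval, where \<open>g\<close> is bounded.\<close>
  have bdd_int: "(\<lambda>t. g (exp (- t)) * H t) absolutely_integrable_on {0..}"
    if "continuous_on {0..1} g" for g :: "real \<Rightarrow> real"
  proof (rule absolutely_integrable_bounded_measurable_product_real[OF _ _ _ int])
    show "(\<lambda>t. g (exp (- t))) \<in> borel_measurable (lebesgue_on {0..})"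
      by (intro continuous_imp_measurable_on_sets_lebesgue continuous_on_compose2[OF that] continuous_intros) auto
    have "bounded (g ` {0..1})"
      using that by (intro compact_imp_bounded compact_continuous_image) auto
    then show "bounded ((\<lambda>t. g (exp (- t))) ` {0..})"
      by (rule bounded_subset) auto
  qed auto
  have poly0: "integral {0..} (\<lambda>t. p (exp (- t)) * H t) = 0" if pol: "real_polynomial_function p" for p
  proof -
    obtain a n where p: "p = (\<lambda>x. \<Sum>i\<le>n. a i * x ^ i)"
      using pol[unfolded real_polynomial_function_iff_sum] by blast
    have pw: "(exp (- t)) ^ i = exp (- real i * t)" for t i
      by (simp add: exp_of_nat_mult[symmetric])
    have "(\<lambda>t. exp (- real i * t) * H t) integrable_on {0..}" for i
      using bdd_int[OF continuous_on_power[OF continuous_on_id], of i]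
      by (auto simp: pw dest: set_lebesgue_integral_eq_integral(1))
    then have "((\<lambda>t. exp (- real i * t) * H t) has_integral 0) {0..}" for i
      using mom[of i] by (metis integrable_integral)
    then have "((\<lambda>t. \<Sum>i\<le>n. a i * (exp (- real i * t) * H t)) has_integral (\<Sum>i\<le>n. a i * 0)) {0..}"
      by (intro has_integral_sum has_integral_mult_right) auto
    then show ?thesis
      by (simp add: p pw sum_distrib_right mult.assoc integral_unique)
  qed
  have cont0: "integral {0..} (\<lambda>t. g (exp (- t)) * H t) = 0" if g: "continuous_on {0..1} g" for g
  proof (rule ccontr)
    let ?I = "integral {0..} (\<lambda>t. g (exp (- t)) * H t)" and ?M = "integral {0..} (\<lambda>t. \<bar>H t\<bar>)"
    assume I: "?I \<noteq> 0"
    have absH: "(\<lambda>t. \<bar>H t\<bar>) integrable_on {0..}"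
      using int by (simp add: absolutely_integrable_on_def)
    have M: "0 \<le> ?M" by (intro integral_nonneg absH) auto
    \<comment> \<open>This keeps the approximation error \<open>e * ?M\<close> at most half of
      \<bar>\<open>?I\<close>\<bar>; the added 1 guards against \<open>?M = 0\<close>.\<close>
    define e where "e = \<bar>?I\<bar> / (2 * (?M + 1))"
    have e: "0 < e" using I M by (simp add: e_def)
    obtain p where p: "real_polynomial_function p" "\<And>x. x \<in> {0..1} \<Longrightarrow> \<bar>g x - p x\<bar> < e"
      using Stone_Weierstrass_polynomial_function[OF compact_Icc g e]
      by (auto simp: real_polynomial_function_eq)
    have cp: "continuous_on {0..1} p"
      using p(1) by (simp add: continuous_on_polymonial_function real_polynomial_function_eq)
    have 1: "(\<lambda>t. g (exp (- t)) * H t) integrable_on {0..}" "(\<lambda>t. p (exp (- t)) * H t) integrable_on {0..}"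
      using bdd_int[OF g] bdd_int[OF cp] by (auto dest: set_lebesgue_integral_eq_integral(1))
    have "?I = integral {0..} (\<lambda>t. g (exp (- t)) * H t - p (exp (- t)) * H t)"
      using poly0[OF p(1)] 1 by (simp add: Henstock_Kurzweil_Integration.integral_diff)
    also have "\<bar>\<dots>\<bar> \<le> integral {0..} (\<lambda>t. e * \<bar>H t\<bar>)"
      unfolding real_norm_def[symmetric]
    proof (rule Henstock_Kurzweil_Integration.integral_norm_bound_integral)
      fix t :: real assume "t \<in> {0..}"
      then have "\<bar>g (exp (- t)) - p (exp (- t))\<bar> \<le> e"
        using p(2)[of "exp (- t)"] by simp
      then show "norm (g (exp (- t)) * H t - p (exp (- t)) * H t) \<le> e * norm (H t)"
        by (simp add: abs_mult mult_right_mono flip: left_diff_distrib)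
    qed (use 1 absH in \<open>auto intro!: Henstock_Kurzweil_Integration.integrable_diff integrable_on_mult_right\<close>)
    also have "\<dots> = e * ?M" by simp
    also have "\<dots> \<le> \<bar>?I\<bar> / 2"
      using M by (simp add: e_def field_simps mult_left_mono)
    also have "\<dots> < \<bar>?I\<bar>" using I by simp
    finally show False by simp
  qed
  \<comment> \<open>Truncating at a time strictly after \<open>t\<close> keeps the weight at
    \<open>t\<close> positive.\<close>
  define b where "b = t + 1"
  define a where "a = exp (- b)"
  \<comment> \<open>The first factor cuts off times from \<open>b\<close> on, and
    \<open>max x a\<close> keeps the logarithm away from 0. The factor \<open>H\<close> makes the
    integrand below a nonnegative weight times the square of \<open>H\<close>.\<close>
  define g where "g x = max 0 (x - a) * H (- ln (max x a))" for x
  have a0: "0 < a" by (simp add: a_def)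
  have cg: "continuous_on {0..1} g"
    unfolding g_def
  proof (intro continuous_intros continuous_on_compose2[OF cont])
    show "(\<lambda>x. - ln (max x a)) ` {0..1} \<subseteq> {0..}"
    proof (intro image_subsetI)
      fix x :: real assume "x \<in> {0..1}"
      then have "0 < max x a" "max x a \<le> 1" using t a0 by (simp_all add: less_max_iff_disj a_def b_def)
      then show "- ln (max x a) \<in> {0..}" by simp
    qed
  qed (use a0 in auto)
  have geq: "g (exp (- u)) * H u = max 0 (exp (- u) - a) * (H u)\<^sup>2" for u
  proof (cases "exp (- u) \<le> a")
    case False
    then have "max (exp (- u)) a = exp (- u)" by simp
    then show ?thesis by (simp add: g_def power2_eq_square)
  qed (simp add: g_def)
  let ?h = "\<lambda>u. max 0 (exp (- u) - a) * (H u)\<^sup>2"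
  have h_int: "?h integrable_on {0..}"
    using bdd_int[OF cg] unfolding geq by (auto dest: set_lebesgue_integral_eq_integral(1))
  have h_cont: "continuous_on {0..b} ?h"
    by (intro continuous_intros continuous_on_subset[OF cont]) auto
  \<comment> \<open>A continuous nonnegative function with integral 0 vanishes pointwise.\<close>
  have "integral {0..b} ?h \<le> integral {0..} ?h"
    using h_int h_cont by (intro integral_subset_le integrable_continuous_interval) auto
  also have "\<dots> = 0" using cont0[OF cg] by (simp add: geq)
  finally have "integral {0..b} ?h = 0"
    using h_cont by (intro antisym integral_nonneg integrable_continuous_interval) auto
  then have "?h t = 0"
    using integral_eq_0_iff[OF h_cont] t by (auto simp: b_def)
  moreover have "a < exp (- t)" by (simp add: a_def b_def)
  ultimately show ?thesis by simp
qed

text \<open>Lerch's theorem. The transform of the difference vanishes at \<open>\<sigma> + n\<close>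
  for every natural \<open>n\<close>; these values are the exponential moments of the integrable
  function \<open>exp (- \<sigma> * u) * (f u - g u)\<close>.\<close>

lemma is_inverse_laplace_unique:
  assumes f: "is_inverse_laplace F f" and g: "is_inverse_laplace F g" and t: "0 \<le> t"
  shows "f t = g t"
proof -
  obtain c1 where c1: "\<And>s. Re s > c1 \<Longrightarrow>
      (\<lambda>t. exp (- s * of_real t) * of_real (f t)) absolutely_integrable_on {0..} \<and>
      integral {0..} (\<lambda>t. exp (- s * of_real t) * of_real (f t)) = F s"
    using f unfolding is_inverse_laplace_def by blast
  obtain c2 where c2: "\<And>s. Re s > c2 \<Longrightarrow>
      (\<lambda>t. exp (- s * of_real t) * of_real (g t)) absolutely_integrable_on {0..} \<and>
      integral {0..} (\<lambda>t. exp (- s * of_real t) * of_real (g t)) = F s"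
    using g unfolding is_inverse_laplace_def by blast
  define \<sigma> where "\<sigma> = max c1 c2 + 1"
  let ?k = "\<lambda>x u. exp (- x * u) * (f u - g u)"
  have *: "?k x absolutely_integrable_on {0..} \<and> integral {0..} (?k x) = 0" if "\<sigma> \<le> x" for x
  proof -
    let ?K = "\<lambda>u. exp (- of_real x * of_real u) * of_real (f u) - exp (- of_real x * of_real u) * complex_of_real (g u)"
    have x: "Re (of_real x) > c1" "Re (of_real x) > c2" using that by (auto simp: \<sigma>_def)
    have ai: "?K absolutely_integrable_on {0..}"
      using c1[OF x(1)] c2[OF x(2)] by (intro set_integral_diff(1)) auto
    have "integral {0..} ?K = 0"
      using c1[OF x(1)] c2[OF x(2)]
      by (subst Henstock_Kurzweil_Integration.integral_diff) (auto dest: set_lebesgue_integral_eq_integral(1))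
    then have hi: "(?K has_integral 0) {0..}"
      using ai by (metis integrable_integral set_lebesgue_integral_eq_integral(1))
    have ReK: "Re \<circ> ?K = ?k x"
    proof
      fix u
      have "?K u = of_real (?k x u)" by (simp add: exp_of_real[symmetric] algebra_simps)
      then show "(Re \<circ> ?K) u = ?k x u" by (metis comp_apply Re_complex_of_real)
    qed
    show ?thesis
      using absolutely_integrable_linear[OF ai bounded_linear_Re] has_integral_linear[OF hi bounded_linear_Re]
      unfolding ReK by (auto dest: integral_unique)
  qed
  have "?k \<sigma> t = 0"
  proof (rule exp_moments_zero_imp_zero[OF _ _ _ t])
    show "continuous_on {0..} (?k \<sigma>)"
      using f g by (intro continuous_intros) (auto simp: is_inverse_laplace_def)
    show "?k \<sigma> absolutely_integrable_on {0..}" using * by blast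
    show "integral {0..} (\<lambda>t. exp (- real n * t) * ?k \<sigma> t) = 0" for n
    proof -
      have "exp (- (\<sigma> + real n) * t) = exp (- real n * t) * exp (- \<sigma> * t)" for t
        by (simp add: algebra_simps flip: exp_add)
      then show ?thesis using *[of "\<sigma> + real n"] by (simp add: mult.assoc)
    qed
  qed
  then show ?thesis by simp
qed

lemma inverse_laplace_eq:
  assumes "is_inverse_laplace F f" and "0 \<le> t"
  shows "inverse_laplace F t = f t"
  unfolding inverse_laplace_def
  using is_inverse_laplace_unique[OF someI[of "is_inverse_laplace F"] assms(1,2)] assms(1) by blast

lemma is_inverse_laplace_exponential_sum:
  assumes "finite S" and pos: "\<And>a. a \<in> S \<Longrightarrow> 0 < a"
    and F: "\<And>s. 0 < Re s \<Longrightarrow> F s = (\<Sum>a\<in>S. of_real (c a) / (s + of_real a))"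
  shows "is_inverse_laplace F (\<lambda>t. \<Sum>a\<in>S. c a * exp (- a * t))"
  unfolding is_inverse_laplace_def
\<comment> \<open>The abscissa 0 works because every rate is positive, whence
  \<open>Re s + a > 0\<close>.\<close>
proof (intro conjI exI[of _ 0] allI impI)
  show "continuous_on {0..} (\<lambda>t. \<Sum>a\<in>S. c a * exp (- a * t))"
    by (intro continuous_intros)
  fix s :: complex assume s: "0 < Re s"
  let ?e = "\<lambda>a t. exp (- s * of_real t) * complex_of_real (exp (- a * t))"
  have eq: "(\<lambda>t. exp (- s * of_real t) * complex_of_real (\<Sum>a\<in>S. c a * exp (- a * t)))
      = (\<lambda>t. \<Sum>a\<in>S. of_real (c a) * ?e a t)"
    by (simp add: sum_distrib_left mult_ac)
  have ai: "?e a absolutely_integrable_on {0..}" and ie: "integral {0..} (?e a) = 1 / (s + of_real a)"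
    if "a \<in> S" for a
    using laplace_exponential[of s a] s pos[OF that] by auto
  show "(\<lambda>t. exp (- s * of_real t) * complex_of_real (\<Sum>a\<in>S. c a * exp (- a * t)))
      absolutely_integrable_on {0..}"
    unfolding eq using assms(1) ai by (intro absolutely_integrable_sum set_integrable_mult_right) auto
  have "(?e a has_integral 1 / (s + of_real a)) {0..}" if "a \<in> S" for a
    using ai[OF that] ie[OF that] by (metis integrable_integral set_lebesgue_integral_eq_integral(1))
  then have "((\<lambda>t. \<Sum>a\<in>S. of_real (c a) * ?e a t) has_integral
      (\<Sum>a\<in>S. of_real (c a) * (1 / (s + of_real a)))) {0..}"
    by (intro has_integral_sum has_integral_mult_right assms(1)) auto
  then show "integral {0..} (\<lambda>t. exp (- s * of_real t) * complex_of_real (\<Sum>a\<in>S. c a * exp (- a * t))) = F s"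
    unfolding eq using F[OF s] by (simp add: integral_unique)
qed

section \<open>Internal variables\<close>

text \<open>Variation of constants: the integrating factor
  \<open>exp (- \<alpha> * (t - \<tau>))\<close> turns the equation into an exact derivative in
  \<open>\<tau>\<close>, integrated from 0 to \<open>t\<close>.\<close>

lemma solves_internal_imp_eq:
  assumes "continuous_on {0..T} w" and sol: "solves_internal T \<alpha> \<beta> w \<xi>" and t: "t \<in> {0..T}"
  shows "\<xi> t = integral {0..t} (\<lambda>\<tau>. \<beta> * exp (- \<alpha> * (t - \<tau>)) * w \<tau>)"
proof -
  have "((\<lambda>\<tau>. exp (- \<alpha> * (t - \<tau>)) * \<xi> \<tau>) has_vector_derivative \<beta> * exp (- \<alpha> * (t - \<tau>)) * w \<tau>)
      (at \<tau> within {0..t})" if "\<tau> \<in> {0..t}" for \<tau>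
  proof -
    have "(\<xi> has_real_derivative (\<beta> * w \<tau> - \<alpha> * \<xi> \<tau>)) (at \<tau> within {0..T})"
      using sol t that unfolding solves_internal_def by auto
    then have "(\<xi> has_real_derivative (\<beta> * w \<tau> - \<alpha> * \<xi> \<tau>)) (at \<tau> within {0..t})"
      by (rule DERIV_subset) (use t in auto)
    then have "((\<lambda>\<tau>. exp (- \<alpha> * (t - \<tau>)) * \<xi> \<tau>) has_real_derivative \<beta> * exp (- \<alpha> * (t - \<tau>)) * w \<tau>)
      (at \<tau> within {0..t})"
      by (auto intro!: derivative_eq_intros simp: algebra_simps)
    then show ?thesis by (simp add: has_real_derivative_iff_has_vector_derivative)
  qed
  then have "((\<lambda>\<tau>. \<beta> * exp (- \<alpha> * (t - \<tau>)) * w \<tau>) has_integral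
      exp (- \<alpha> * (t - t)) * \<xi> t - exp (- \<alpha> * (t - 0)) * \<xi> 0) {0..t}"
    using t by (intro fundamental_theorem_of_calculus) auto
  then show ?thesis using sol by (simp add: solves_internal_def integral_unique)
qed

lemma solves_internal_exists:
  assumes "continuous_on {0..T} w"
  shows "\<exists>\<xi>. solves_internal T \<alpha> \<beta> w \<xi>"
proof
  \<comment> \<open>With \<open>exp (- \<alpha> * t)\<close> taken out of the convolution,
    \<open>t\<close> enters the integral only through its upper limit.\<close>
  define G where "G t = integral {0..t} (\<lambda>\<tau>. exp (\<alpha> * \<tau>) * w \<tau>)" for t
  let ?\<xi> = "\<lambda>t. exp (- \<alpha> * t) * (\<beta> * G t)"
  have "(?\<xi> has_real_derivative \<beta> * w t - \<alpha> * ?\<xi> t) (at t within {0..T})" if "t \<in> {0..T}" for t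
  proof -
    have "continuous_on {0..T} (\<lambda>\<tau>. exp (\<alpha> * \<tau>) * w \<tau>)"
      using assms by (intro continuous_intros)
    from integral_has_real_derivative[OF this that]
    have d: "(G has_real_derivative exp (\<alpha> * t) * w t) (at t within {0..T})"
      unfolding G_def .
    have "(?\<xi> has_real_derivative exp (- \<alpha> * t) * (\<beta> * (exp (\<alpha> * t) * w t)) - \<alpha> * ?\<xi> t) (at t within {0..T})"
      by (auto intro!: derivative_eq_intros d simp: algebra_simps)
    moreover have "exp (- \<alpha> * t) * (\<beta> * (exp (\<alpha> * t) * w t)) = \<beta> * w t"
      by (simp add: exp_minus)
    ultimately show ?thesis by (simp only:)
  qed
  then show "solves_internal T \<alpha> \<beta> w ?\<xi>" by (simp add: solves_internal_def G_def)
qed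

lemma internal_variable_eq:
  assumes "continuous_on {0..T} w" and "t \<in> {0..T}"
  shows "internal_variable T \<alpha> \<beta> w t = integral {0..t} (\<lambda>\<tau>. \<beta> * exp (- \<alpha> * (t - \<tau>)) * w \<tau>)"
  unfolding internal_variable_def
  using solves_internal_imp_eq[OF assms(1) someI_ex[OF solves_internal_exists[OF assms(1)]] assms(2)] .

section \<open>The memory kernel of a piecewise constant material\<close>

lemma has_integral_piecewise_constant:
  fixes a :: "nat \<Rightarrow> real" and f :: "real \<Rightarrow> 'a::euclidean_space"
  assumes "\<And>i. i < N \<Longrightarrow> a i < a (Suc i)"
    and "\<And>i y. i < N \<Longrightarrow> y \<in> {a i..<a (Suc i)} \<Longrightarrow> f y = c i"
  shows "(f has_integral (\<Sum>i<N. (a (Suc i) - a i) *\<^sub>R c i)) {a 0..a N}"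
  using assms
proof (induction N)
  case (Suc N)
  note step = Suc.prems(1)
  have "a 0 \<le> a n" if "n \<le> Suc N" for n
    using that
  proof (induction n)
    case (Suc k)
    then show ?case using step[of k] by simp
  qed simp
  moreover have "((\<lambda>y. c N) has_integral (a (Suc N) - a N) *\<^sub>R c N) {a N..a (Suc N)}"
    using has_integral_const_real[of "c N" "a N" "a (Suc N)"] Suc.prems(1)[of N] by simp
  \<comment> \<open>The right end point belongs to no piece so far, but a single point does not
    affect the integral.\<close>
  then have "(f has_integral (a (Suc N) - a N) *\<^sub>R c N) {a N..a (Suc N)}"
    by (rule has_integral_spike_finite[of "{a (Suc N)}", rotated 2]) (use Suc.prems(2)[of N] in auto)
  ultimately show ?case
    using has_integral_combine[of "a 0" "a N" "a (Suc N)"] Suc.IH Suc.prems by (simp add: less_imp_le)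
qed (simp add: has_integral_refl)

text \<open>A positive essential infimum makes \<open>f\<close> positive almost everywhere, and an
  interval of positive length is not a null set.\<close>

lemma ess_inf_pos_imp_piece_pos:
  assumes "0 < ess_inf f" and "a < b" and "\<And>y. y \<in> {a..<b} \<Longrightarrow> f y = c"
  shows "0 < c"
proof (rule ccontr)
  assume "\<not> 0 < c"
  have "esssup lborel (\<lambda>y. - ereal (f y)) < 0"
    using assms(1) by (simp add: ess_inf_def ereal_less_uminus_reorder)
  moreover have "AE y in lborel. - ereal (f y) \<le> esssup lborel (\<lambda>y. - ereal (f y))"
    by (rule esssup_AE)
  ultimately have "AE y in lborel. 0 < f y"
    by (auto elim!: eventually_mono dest: le_less_trans)
  then have "AE y in lborel. y \<notin> {a..<b}"
    using assms(3) \<open>\<not> 0 < c\<close> by (auto elim!: eventually_mono)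
  then have "emeasure lborel {a..<b} = 0"
    by (subst (asm) AE_iff_measurable[of "{a..<b}"]) auto
  then show False using assms(2) by simp
qed

text \<open>Merges pieces of equal ratio, so that the poles become distinct and their weights add
  up.\<close>

lemma sum_by_value:
  fixes r w :: "nat \<Rightarrow> real" and g :: "real \<Rightarrow> 'a::real_algebra_1"
  shows "(\<Sum>i<N. of_real (w i) * g (r i)) =
    (\<Sum>\<rho>\<in>r ` {..<N}. of_real (\<Sum>i | i < N \<and> r i = \<rho>. w i) * g \<rho>)"
  by (subst sum.image_gen[of _ _ r]) (auto simp: sum_distrib_right intro!: sum.cong)

text \<open>Pieces with equal ratio \<open>E / \<nu>\<close> contribute the same pole, so there can be fewer than
  \<open>N - 1\<close> relaxation rates.\<close>

lemma kappa_hat_pole_expansion: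
  assumes N: "0 < N" and pc: "piecewise_constant_pair N E \<nu>"
    and inf: "0 < ess_inf E" "0 < ess_inf \<nu>"
  obtains S :: "real set" and c where
    "finite S" "card S \<le> N - 1" "\<And>a. a \<in> S \<Longrightarrow> 0 < a"
    "\<And>s. 0 < Re s \<Longrightarrow> kappa_hat E \<nu> s = (\<Sum>a\<in>S. of_real (c a) / (s + of_real a))"
    "0 < nu_hom \<nu>" "0 < E_hom E \<nu>"
proof -
  obtain a e n where a: "a 0 = 0" "a N = 1" "\<And>i. i < N \<Longrightarrow> a i < a (Suc i)"
    and en: "\<And>i y. i < N \<Longrightarrow> y \<in> {a i..<a (Suc i)} \<Longrightarrow> E y = e i \<and> \<nu> y = n i"
    using pc unfolding piecewise_constant_pair_def by metis
  have e: "0 < e i" and n: "0 < n i" if "i < N" for i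
    using ess_inf_pos_imp_piece_pos[OF inf(1) a(3)[OF that]] en[OF that]
      ess_inf_pos_imp_piece_pos[OF inf(2) a(3)[OF that]] by blast+
  \<comment> \<open>On piece \<open>i\<close> the integrand is
    \<open>1 / (s * n i + e i) = (1 / n i) / (s + e i / n i)\<close>: a pole at \<open>- r i\<close>
    which, after integration over the piece, has weight \<open>d i\<close>.\<close>
  define d where "d i = (a (Suc i) - a i) / n i" for i
  define r where "r i = e i / n i" for i
  define R where "R = r ` {..<N}"
  define w where "w \<rho> = (\<Sum>i | i < N \<and> r i = \<rho>. d i)" for \<rho>
  have d: "0 < d i" and r: "0 < r i" if "i < N" for i
    using a(3) e n that by (simp_all add: d_def r_def)
  have fin: "finite R" "R \<noteq> {}" using N by (auto simp: R_def)
  have pos: "\<forall>r\<in>R. 0 < r \<and> 0 < w r"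
    using r d by (auto simp: R_def w_def intro!: sum_pos)
  have int: "integral {0..1} f = (\<Sum>i<N. (a (Suc i) - a i) *\<^sub>R c i)"
    if "\<And>i y. i < N \<Longrightarrow> E y = e i \<Longrightarrow> \<nu> y = n i \<Longrightarrow> f y = c i"
    for f :: "real \<Rightarrow> 'b::euclidean_space" and c
    using has_integral_piecewise_constant[of N a f c] a en that by (auto intro: integral_unique)
  have "integral {0..1} (\<lambda>y. 1 / \<nu> y) = (\<Sum>i<N. of_real (d i) * 1)"
    by (subst int[of _ "\<lambda>i. 1 / n i"]) (auto simp: d_def)
  also have "\<dots> = (\<Sum>\<rho>\<in>R. w \<rho>)"
    unfolding R_def w_def by (subst sum_by_value) simp
  finally have W: "integral {0..1} (\<lambda>y. 1 / \<nu> y) = (\<Sum>\<rho>\<in>R. w \<rho>)" .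
  have "integral {0..1} (\<lambda>y. E y / (\<nu> y)\<^sup>2) = (\<Sum>i<N. of_real (d i) * r i)"
    by (subst int[of _ "\<lambda>i. e i / (n i)\<^sup>2"]) (auto simp: d_def r_def power2_eq_square)
  also have "\<dots> = (\<Sum>\<rho>\<in>R. w \<rho> * \<rho>)"
    unfolding R_def w_def by (subst sum_by_value) simp
  finally have B: "integral {0..1} (\<lambda>y. E y / (\<nu> y)\<^sup>2) = (\<Sum>\<rho>\<in>R. w \<rho> * \<rho>)" .
  have g: "integral {0..1} (\<lambda>y. 1 / (s * of_real (\<nu> y) + of_real (E y))) =
      (\<Sum>\<rho>\<in>R. of_real (w \<rho>) / (s + of_real \<rho>))" if s: "0 < Re s" for s :: complex
  proof -
    have "(a (Suc i) - a i) *\<^sub>R (1 / (s * of_real (n i) + of_real (e i))) =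
        of_real (d i) * (1 / (s + of_real (r i)))" if "i < N" for i
    proof -
      have "s + of_real (r i) \<noteq> 0" using s r[OF that] by (auto simp: complex_eq_iff)
      moreover have "s * of_real (n i) + of_real (e i) = of_real (n i) * (s + of_real (r i))"
        using n[OF that] by (simp add: r_def field_simps)
      ultimately show ?thesis
        using n[OF that] by (simp add: d_def scaleR_conv_of_real)
    qed
    then have "integral {0..1} (\<lambda>y. 1 / (s * of_real (\<nu> y) + of_real (E y))) =
        (\<Sum>i<N. of_real (d i) * (1 / (s + of_real (r i))))"
      by (subst int[of _ "\<lambda>i. 1 / (s * of_real (n i) + of_real (e i))"]) auto
    also have "\<dots> = (\<Sum>\<rho>\<in>R. of_real (w \<rho>) * (1 / (s + of_real \<rho>)))"
      unfolding R_def w_def by (rule sum_by_value)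
    finally show ?thesis by simp
  qed
  obtain S c where S: "finite S" "card S = card R - 1" "\<And>a. a \<in> S \<Longrightarrow> 0 < a"
    and c: "\<And>s. 0 < Re s \<Longrightarrow> inverse (\<Sum>r\<in>R. of_real (w r) / (s + of_real r)) =
      of_real (1 / (\<Sum>r\<in>R. w r)) * s + of_real ((\<Sum>r\<in>R. w r * r) / (\<Sum>r\<in>R. w r)\<^sup>2) +
      (\<Sum>a\<in>S. of_real (c a) / (s + of_real a))"
    using inverse_pole_sum[OF fin pos] by blast
  have "card R \<le> N" using card_image_le[of "{..<N}" r] by (simp add: R_def)
  moreover have "0 < (\<Sum>\<rho>\<in>R. w \<rho>)" "0 < (\<Sum>\<rho>\<in>R. w \<rho> * \<rho>)"
    using fin pos by (auto intro!: sum_pos)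
  \<comment> \<open>By \<open>W\<close> and \<open>B\<close> the linear part of the reciprocal is
    exactly \<open>nu_hom \<nu> * s + E_hom E \<nu>\<close>, so \<open>kappa_hat\<close> is the
    remaining pole sum.\<close>
  ultimately show ?thesis
    using that[of S c] S c
    by (simp add: kappa_hat_def a0_hat_def nu_hom_def E_hom_def W B g inverse_eq_divide)
qed

lemma kappa_eq_exponential_sum:
  assumes "piecewise_constant_pair (L + 1) E \<nu>"
    and "0 < ess_inf E" "0 < ess_inf \<nu>"
  obtains \<alpha> \<beta> :: "real list" where
    "length \<alpha> = L" "length \<beta> = L" "\<forall>a\<in>set \<alpha>. 0 < a"
    "\<And>t. 0 \<le> t \<Longrightarrow> kappa E \<nu> t = - (\<Sum>l<L. \<beta> ! l * exp (- \<alpha> ! l * t))"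
    "0 < nu_hom \<nu>" "0 < E_hom E \<nu>"
proof -
  obtain S :: "real set" and c where S: "finite S" "card S \<le> L" "\<And>a. a \<in> S \<Longrightarrow> 0 < a"
    and F: "\<And>s. 0 < Re s \<Longrightarrow> kappa_hat E \<nu> s = (\<Sum>a\<in>S. of_real (c a) / (s + of_real a))"
    and hom: "0 < nu_hom \<nu>" "0 < E_hom E \<nu>"
    using kappa_hat_pole_expansion[of "L + 1" E \<nu>] assms by auto
  obtain xs where xs: "set xs = S" "distinct xs"
    using finite_distinct_list[OF S(1)] by blast
  have len: "length xs \<le> L" using S(2) distinct_card[OF xs(2)] xs(1) by simp
  \<comment> \<open>The model prescribes exactly \<open>L\<close> internal variables, so missing
    ones are padded with rate 1 and forcing coefficient 0. The sign of \<open>c\<close> flips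
    because \<open>Psi_PC\<close> subtracts the internal variables.\<close>
  let ?k = "L - length xs"
  let ?\<alpha> = "xs @ replicate ?k 1" and ?\<beta> = "map (\<lambda>a. - c a) xs @ replicate ?k 0"
  show ?thesis
  proof
    show "length ?\<alpha> = L" "length ?\<beta> = L" using len by auto
    show "\<forall>a\<in>set ?\<alpha>. 0 < a" using S(3) xs by auto
    fix t :: real assume t: "0 \<le> t"
    have "(\<Sum>l<L. ?\<beta> ! l * exp (- ?\<alpha> ! l * t)) =
        (\<Sum>l<length xs. ?\<beta> ! l * exp (- ?\<alpha> ! l * t))"
      using len by (intro sum.mono_neutral_right) (auto simp: nth_append)
    also have "\<dots> = (\<Sum>l<length xs. - c (xs ! l) * exp (- (xs ! l) * t))"
      by (intro sum.cong) (auto simp: nth_append)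
    also have "\<dots> = (\<Sum>a\<in>S. - c a * exp (- a * t))"
      using sum.reindex_bij_betw[OF bij_betw_nth[OF xs(2) refl xs(1)[symmetric]], of "\<lambda>a. - c a * exp (- a * t)"] by simp
    finally have "(\<Sum>l<L. ?\<beta> ! l * exp (- ?\<alpha> ! l * t)) = - (\<Sum>a\<in>S. c a * exp (- a * t))"
      by (simp add: sum_negf)
    then show "kappa E \<nu> t = - (\<Sum>l<L. ?\<beta> ! l * exp (- ?\<alpha> ! l * t))"
      unfolding kappa_def
      using inverse_laplace_eq[OF is_inverse_laplace_exponential_sum[OF S(1,3) F] t] by simp
  qed (fact hom)+
qed

section \<open>Equality of the two constitutive maps\<close>

lemma Psi_dagger_eq_Psi_PC:
  assumes w: "continuous_on {0..T} w" and t: "t \<in> {0..T}"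
    and \<kappa>: "\<And>t. 0 \<le> t \<Longrightarrow> kappa E \<nu> t = - (\<Sum>l<L. \<beta> ! l * exp (- \<alpha> ! l * t))"
  shows "Psi_dagger E \<nu> p q w t = Psi_PC T p q w t (E_hom E \<nu>, nu_hom \<nu>, L, \<alpha>, \<beta>)"
proof -
  let ?f = "\<lambda>l \<tau>. \<beta> ! l * exp (- \<alpha> ! l * (t - \<tau>)) * w \<tau>"
  have "integral {0..t} (\<lambda>\<tau>. kappa E \<nu> (t - \<tau>) * w \<tau>) = integral {0..t} (\<lambda>\<tau>. - (\<Sum>l<L. ?f l \<tau>))"
    by (intro integral_cong) (simp add: \<kappa> sum_distrib_right)
  also have "\<dots> = - (\<Sum>l<L. integral {0..t} (?f l))"
    using t unfolding integral_neg
    by (subst integral_sum)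
      (auto intro!: integrable_continuous_interval continuous_intros continuous_on_subset[OF w])
  \<comment> \<open>Each single-exponential convolution is the variation-of-constants solution,
    hence the chosen internal variable.\<close>
  also have "\<dots> = - (\<Sum>l<L. internal_variable T (\<alpha> ! l) (\<beta> ! l) w t)"
    by (simp add: internal_variable_eq[OF w t])
  finally show ?thesis by (simp add: Psi_dagger_def Psi_PC_def)
qed

theorem theorem3p6:
  fixes D :: "real set" and T :: real and L' :: nat and E \<nu> :: "real \<Rightarrow> real"
  assumes "is_interval D" and "bounded D" and "interior D \<noteq> {}"
    and "0 < T"
    and "0 < L'"
    and "one_periodic E" and "one_periodic \<nu>"
    and "piecewise_constant_pair (L' + 1) E \<nu>"
    and "ess_sup E < \<infinity>" and "ess_sup \<nu> < \<infinity>"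
    and "0 < ess_inf E" and "0 < ess_inf \<nu>"
  shows "\<exists>\<theta>\<in>Theta. (\<exists>\<alpha> \<beta>. \<theta> = (E_hom E \<nu>, nu_hom \<nu>, L', \<alpha>, \<beta>)) \<and>
    (\<forall>u\<^sub>0. Ck_on 2 (closure D) {0..T} u\<^sub>0 \<longrightarrow>
      (\<forall>x\<in>closure D. \<forall>t\<in>{0<..<T}.
        Psi_dagger E \<nu>
          (pd_x (closure D) u\<^sub>0 x t)
          (pd_t {0..T} (pd_x (closure D) u\<^sub>0) x t)
          (\<lambda>\<tau>. pd_x (closure D) u\<^sub>0 x \<tau>) t
        = Psi_PC T
          (pd_x (closure D) u\<^sub>0 x t)
          (pd_t {0..T} (pd_x (closure D) u\<^sub>0) x t)
          (\<lambda>\<tau>. pd_x (closure D) u\<^sub>0 x \<tau>) t \<theta>))"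
proof -
  obtain \<alpha> \<beta> :: "real list" where
    len: "length \<alpha> = L'" "length \<beta> = L'" and pos: "\<forall>a\<in>set \<alpha>. 0 < a"
    and \<kappa>: "\<And>t. 0 \<le> t \<Longrightarrow> kappa E \<nu> t = - (\<Sum>l<L'. \<beta> ! l * exp (- \<alpha> ! l * t))"
    and hom: "0 < nu_hom \<nu>" "0 < E_hom E \<nu>"
    using kappa_eq_exponential_sum[OF assms(8,11,12)] by blast
  \<comment> \<open>Unfolding \<open>Ck_on 2\<close> makes the strain jointly continuous; freezing
    \<open>x\<close> yields the continuous history on which the internal variables are
    solvable.\<close>
  have cont: "continuous_on {0..T} (pd_x (closure D) u x)"
    if "Ck_on 2 (closure D) {0..T} u" and "x \<in> closure D" for u x
  proof -
    have "continuous_on (closure D \<times> {0..T}) (\<lambda>(x, t). pd_x (closure D) u x t)"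
      using that(1) by (simp add: numeral_2_eq_2)
    then have "continuous_on {0..T} (\<lambda>t. case (x, t) of (x, t) \<Rightarrow> pd_x (closure D) u x t)"
      by (rule continuous_on_compose2) (use that(2) in \<open>auto intro!: continuous_intros\<close>)
    then show ?thesis by simp
  qed
  show ?thesis
  proof (rule bexI[of _ "(E_hom E \<nu>, nu_hom \<nu>, L', \<alpha>, \<beta>)"])
    show "(E_hom E \<nu>, nu_hom \<nu>, L', \<alpha>, \<beta>) \<in> Theta"
      using len pos hom assms by (simp add: Theta_def)
  qed (use cont \<kappa> in \<open>auto intro!: Psi_dagger_eq_Psi_PC\<close>)
qed

end
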